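(* The set of plants with a suitable Zames-Falb multiplier is not convex. That is, the set $$\{G\in\mathbf{RH}_\infty:\ \exists M\in\mathcal{M}\ \text{such that}\ \mathrm{Re}\{M(e^{j\omega})G(e^{j\omega})\}>0\ \text{for all}\ \omega\in[0,\pi]\}$$ is not convex, and likewise the set obtained by replacing $\mathcal{M}$ by $\mathcal{M}_{\text{odd}}$ is not convex.
   Context: $j$ is the imaginary unit. $\mathbf{RH}_\infty$ is the real vector space of scalar proper rational functions $G(z)$ with real coefficients all of whose poles lie in the open unit disk. For a real two-sided sequence $h=(h_i)_{i\in\mathbb{Z}}$, $\|h\|_1=\sum_{i\in\mathbb{Z}}|h_i|$. Discrete-time LTI Zames-Falb multipliers: $\mathcal{M}$ is the set of functions on the unit circle of the form $M(e^{j\omega})=1-H(e^{j\omega})$, $H(e^{j\omega})=\sum_{i\in\mathbb{Z}}h_ie^{-j\omega i}$, where $h$ is a real sequence with $h_0=0$, $h_i\ge 0$ for all $i$ and $\|h\|_1\le 1$. $\mathcal{M}_{\text{odd}}$ is the set of such functions where $h$ is a real sequence with $h_0=0$ and $\|h\|_1\le 1$ (no sign condition). A multiplier $M$ is suitable for a plant $G$ if $\mathrm{Re}\{M(e^{j\omega})G(e^{j\omega})\}>0$ for all $\omega\in[0,\pi]$. *)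

theory Defs
  imports
    "HOL-Analysis.Analysis"
    "HOL-Computational_Algebra.Computational_Algebra"
    "HOL-Computational_Algebra.Field_as_Ring"
begin

text \<open>
  Rational functions with real coefficients are the elements of \<^typ>\<open>real poly fract\<close>. The
  following two instances make this type a real vector space, so that \<^const>\<open>convex\<close> applies.
\<close>

instantiation poly :: ("{comm_ring_1, real_algebra_1}") real_algebra_1
begin

definition scaleR_poly :: "real \<Rightarrow> 'a poly \<Rightarrow> 'a poly"
  where "scaleR_poly r p = smult (of_real r) p"

instance
  by standard (simp_all add: scaleR_poly_def smult_add_right smult_add_left)

end

instantiation fract :: ("{idom, real_algebra_1}") real_vector
begin

definition scaleR_fract :: "real \<Rightarrow> 'a fract \<Rightarrow> 'a fract"
  where "scaleR_fract r x = to_fract (of_real r) * x"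

instance
  by standard (simp_all add: scaleR_fract_def algebra_simps)

end

lemma scaleR_Fract: "r *\<^sub>R Fract p q = Fract (smult r p) q" for p q :: "real poly"
  by (simp add: scaleR_fract_def to_fract_def of_real_def scaleR_poly_def)

text \<open>Numerator and denominator in lowest terms, as complex polynomials.\<close>

definition rat_num :: "real poly fract \<Rightarrow> complex poly"
  where "rat_num G = map_poly of_real (fst (quot_of_fract G))"

definition rat_den :: "real poly fract \<Rightarrow> complex poly"
  where "rat_den G = map_poly of_real (snd (quot_of_fract G))"

definition rat_eval :: "real poly fract \<Rightarrow> complex \<Rightarrow> complex"
  where "rat_eval G z = poly (rat_num G) z / poly (rat_den G) z"

definition rat_poles :: "real poly fract \<Rightarrow> complex set"
  where "rat_poles G = {z. poly (rat_den G) z = 0}"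

definition rat_proper :: "real poly fract \<Rightarrow> bool"
  where "rat_proper G \<longleftrightarrow> degree (rat_num G) \<le> degree (rat_den G)"

definition RH_inf :: "real poly fract set"
  where "RH_inf = {G. rat_proper G \<and> rat_poles G \<subseteq> ball 0 1}"

lemma map_poly_of_real_mult:
  "map_poly of_real (p * q) = (map_poly of_real p * map_poly of_real q :: complex poly)"
  by (intro poly_eqI) (simp add: coeff_map_poly coeff_mult)

lemma rat_eval_Fract:
  fixes p q :: "real poly"
  assumes "poly (map_poly of_real q) z \<noteq> 0"
  shows "rat_eval (Fract p q) z = poly (map_poly of_real p) z / poly (map_poly of_real q) z"
proof -
  have q: "q \<noteq> 0" using assms by auto
  have "quot_of_fract (Fract p q) = normalize_quot (p, q)"
    using quot_of_fract_quot_to_fract[of "(p, q)"] by (simp add: quot_to_fract_def)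
  moreover define d where "d = gcd p q * unit_factor q"
  ultimately have "p = fst (quot_of_fract (Fract p q)) * d" "q = snd (quot_of_fract (Fract p q)) * d"
    using normalize_quot_aux[OF q, of p] by simp_all
  then have
    "poly (map_poly of_real p) z = poly (rat_num (Fract p q)) z * poly (map_poly of_real d) z"
    "poly (map_poly of_real q) z = poly (rat_den (Fract p q)) z * poly (map_poly of_real d) z"
    unfolding rat_num_def rat_den_def by (metis map_poly_of_real_mult poly_mult)+
  with assms show ?thesis by (simp add: rat_eval_def)
qed

text \<open>
  Since \<^const>\<open>infsum\<close> of a non-summable family is \<open>0\<close>, the bound on the norm has to be accompanied
  by summability.
\<close>

definition l1_norm_le_1 :: "(int \<Rightarrow> real) \<Rightarrow> bool"
  where "l1_norm_le_1 h \<longleftrightarrow>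
    (\<lambda>i. \<bar>h i\<bar>) summable_on UNIV \<and> (\<Sum>\<^sub>\<infinity>i. \<bar>h i\<bar>) \<le> 1"

definition multiplier :: "(int \<Rightarrow> real) \<Rightarrow> complex \<Rightarrow> complex"
  where "multiplier h =
    restrict (\<lambda>z. 1 - (\<Sum>\<^sub>\<infinity>i. of_real (h i) * z powi (- i))) (sphere 0 1)"

definition ZF :: "(complex \<Rightarrow> complex) set"
  where "ZF = {multiplier h | h. h 0 = 0 \<and> (\<forall>i. 0 \<le> h i) \<and> l1_norm_le_1 h}"

definition ZF_odd :: "(complex \<Rightarrow> complex) set"
  where "ZF_odd = {multiplier h | h. h 0 = 0 \<and> l1_norm_le_1 h}"

definition suitable :: "(complex \<Rightarrow> complex) \<Rightarrow> real poly fract \<Rightarrow> bool"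
  where "suitable M G \<longleftrightarrow> (\<forall>\<omega>\<in>{0..pi}. Re (M (cis \<omega>) * rat_eval G (cis \<omega>)) > 0)"

end

theory Submission
  imports Defs
begin

text \<open>
  Let \<open>a = 4/5\<close>, \<open>P = 1 + a z\<^sup>-\<^sup>2\<close>, \<open>D = 1 - a z\<^sup>-\<^sup>1\<close> and \<open>G = P / D\<close>. The multiplier \<open>D\<close> is suitable
  for \<open>G\<close>, because \<open>D G = P\<close> has positive real part on the unit circle. The multiplier \<open>1 - a z\<close>,
  which is the conjugate of \<open>D\<close> there, is suitable for \<open>1 / G\<close>, because \<open>\<bar>D\<bar>\<^sup>2 / P\<close> has positive
  real part. At \<open>\<omega> = \<pi>/3\<close> the value of \<open>G\<close> has modulus \<open>1\<close> and phase beyond \<open>-90\<close> degrees, so the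
  mean of \<open>G\<close> and \<open>1 / G\<close> takes the negative real value \<open>-1/7\<close>. Every Zames-Falb multiplier has
  nonnegative real part, so none is suitable for the mean.
\<close>

text \<open>Passing to lowest terms cancels one factor \<open>d\<close> from both \<open>p\<close>
  and \<open>q\<close>. This keeps the order of the degrees, and the reduced denominator gains no
  new roots.\<close>

lemma Fract_in_RH_inf:
  fixes p q :: "real poly"
  assumes q: "q \<noteq> 0" and deg: "degree p \<le> degree q"
    and roots: "\<And>z. poly (map_poly of_real q) z = (0 :: complex) \<Longrightarrow> norm z < 1"
  shows "Fract p q \<in> RH_inf"
proof -
  have "quot_of_fract (Fract p q) = normalize_quot (p, q)"
    using quot_of_fract_quot_to_fract[of "(p, q)"] by (simp add: quot_to_fract_def)
  moreover define d where "d = gcd p q * unit_factor q"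
  ultimately have pq:
    "p = fst (quot_of_fract (Fract p q)) * d" "q = snd (quot_of_fract (Fract p q)) * d"
    using normalize_quot_aux[OF q, of p] by simp_all
  define n where "n = fst (quot_of_fract (Fract p q))"
  define e where "e = snd (quot_of_fract (Fract p q))"
  have p': "p = n * d" and q': "q = e * d"
    using pq unfolding n_def e_def .
  have de: "d \<noteq> 0" "e \<noteq> 0"
    using q q' by auto
  have "degree n \<le> degree e"
    using deg de unfolding p' q' by (cases "n = 0") (auto simp: degree_mult_eq)
  then have "rat_proper (Fract p q)"
    by (simp add: rat_proper_def rat_num_def rat_den_def n_def e_def degree_map_poly)
  moreover have "norm z < 1" if "z \<in> rat_poles (Fract p q)" for z
  proof (rule roots)
    have "poly (map_poly of_real e) z = 0"
      using that by (simp add: rat_poles_def rat_den_def e_def)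
    then show "poly (map_poly of_real q) z = 0"
      unfolding q' by (simp add: map_poly_of_real_mult)
  qed
  ultimately show ?thesis
    by (auto simp: RH_inf_def)
qed

text \<open>On the circle the terms have modulus |h i|, so the sum lies in the closed unit disk. The
  bound involves only absolute values, so it serves \<open>ZF_odd\<close> as well as
  \<open>ZF\<close>.\<close>

lemma Re_multiplier_nonneg:
  assumes h: "l1_norm_le_1 h" and z: "norm z = 1"
  shows "Re (multiplier h z) \<ge> 0"
proof -
  let ?f = "\<lambda>i. of_real (h i) * z powi (- i)"
  have norm: "norm (?f i) = \<bar>h i\<bar>" for i
    using z by (simp add: norm_mult norm_power_int)
  have "norm (\<Sum>\<^sub>\<infinity>i. ?f i) \<le> (\<Sum>\<^sub>\<infinity>i. norm (?f i))"
    using h by (intro norm_infsum_bound) (simp add: norm l1_norm_le_1_def)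
  also have "\<dots> \<le> 1"
    using h by (simp add: norm l1_norm_le_1_def)
  finally have "Re (\<Sum>\<^sub>\<infinity>i. ?f i) \<le> 1"
    using complex_Re_le_cmod order_trans by blast
  then show ?thesis
    using z by (simp add: multiplier_def)
qed

lemma infsum_single:
  fixes f :: "'a \<Rightarrow> 'b :: {topological_comm_monoid_add, t2_space}"
  assumes "\<And>i. i \<noteq> k \<Longrightarrow> f i = 0"
  shows "infsum f UNIV = f k"
proof -
  have "infsum f UNIV = infsum f {k}"
    by (rule infsum_cong_neutral) (use assms in auto)
  then show ?thesis by simp
qed

text \<open>The sequence is supported at the single index \<open>k\<close>; the values 1 and -1 of
  \<open>k\<close> give the two multipliers of the proof.\<close>

lemma monomial_multiplier:
  assumes k: "k \<noteq> 0" and a: "0 \<le> a" "a \<le> 1"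
  obtains M where "M \<in> ZF" "\<And>z. norm z = 1 \<Longrightarrow> M z = 1 - of_real a * z powi (- k)"
proof
  define h where "h i = (if i = k then a else 0)" for i
  have "(\<lambda>i. \<bar>h i\<bar>) summable_on UNIV"
    by (rule finite_nonzero_values_imp_summable_on, rule finite_subset[of _ "{k}"])
      (auto simp: h_def)
  moreover have "(\<Sum>\<^sub>\<infinity>i. \<bar>h i\<bar>) = a"
    using a by (subst infsum_single[where k = k]) (auto simp: h_def)
  ultimately show "multiplier h \<in> ZF"
    using k a by (auto simp: ZF_def l1_norm_le_1_def h_def)
  show "multiplier h z = 1 - of_real a * z powi (- k)" if "norm z = 1" for z
    using that by (simp add: multiplier_def, subst infsum_single[where k = k]) (auto simp: h_def)
qed

lemma ZF_subset_ZF_odd: "ZF \<subseteq> ZF_odd"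
  by (auto simp: ZF_def ZF_odd_def)

lemma Re_one_plus_pos:
  assumes "norm w < 1"
  shows "Re (1 + w) > 0"
  using abs_Re_le_cmod[of w] assms by simp

text \<open>Inversion preserves the right half-plane, as 1/w is a positive multiple of the conjugate
  of w.\<close>

lemma Re_of_real_divide_pos:
  assumes "r > 0" "Re w > 0"
  shows "Re (of_real r / w) > 0"
  using assms by (simp add: Re_divide add_pos_nonneg)

text \<open>The real value \<open>r\<close> factors out: the real part of the product is
  \<open>r\<close> times that of the multiplier, which is nonnegative.\<close>

lemma not_suitable_negative_real:
  assumes M: "M \<in> ZF_odd" and w: "\<omega> \<in> {0..pi}"
    and G: "rat_eval G (cis \<omega>) = of_real r" and r: "r \<le> 0"
  shows "\<not> suitable M G"
proof -
  have "Re (M (cis \<omega>)) \<ge> 0"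
    using M Re_multiplier_nonneg[of _ "cis \<omega>"] by (auto simp: ZF_odd_def)
  then have "Re (M (cis \<omega>) * rat_eval G (cis \<omega>)) \<le> 0"
    using r by (simp add: G mult_nonneg_nonpos)
  then show ?thesis
    using w by (auto simp: suitable_def not_less)
qed

text \<open>The numerators \<open>z\<^sup>2 P\<close> and \<open>z\<^sup>2 D\<close> of the functions \<open>P\<close> and \<open>D\<close> above.\<close>

definition P_poly :: "real poly" where "P_poly = [:4/5, 0, 1:]"

definition D_poly :: "real poly" where "D_poly = [:0, -4/5, 1:]"

lemma poly_P: "poly (map_poly of_real P_poly) z = z\<^sup>2 + of_real (4/5)" for z :: complex
  by (simp add: P_poly_def map_poly_pCons power2_eq_square)

lemma poly_D: "poly (map_poly of_real D_poly) z = z\<^sup>2 - of_real (4/5) * z" for z :: complex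
  by (simp add: D_poly_def map_poly_pCons power2_eq_square algebra_simps)

lemma P_roots: "norm z < 1" if "poly (map_poly of_real P_poly) z = 0" for z :: complex
proof -
  have "z\<^sup>2 = - of_real (4/5)"
    using that unfolding poly_P by (simp add: eq_neg_iff_add_eq_0)
  then have "norm (z\<^sup>2) = 4/5"
    by (simp only: norm_minus_cancel norm_of_real)
  then have "(norm z)\<^sup>2 < 1\<^sup>2" by (simp add: norm_power)
  then show ?thesis using power2_less_imp_less by fastforce
qed

lemma D_roots: "norm z < 1" if "poly (map_poly of_real D_poly) z = 0" for z :: complex
proof -
  have "z * (z - of_real (4/5)) = 0"
    using that unfolding poly_D by (simp add: power2_eq_square algebra_simps)
  then have "z = 0 \<or> z = of_real (4/5)" by (simp only: mult_eq_0_iff right_minus_eq)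
  then show ?thesis by (elim disjE) (simp_all only: norm_of_real, simp_all)
qed

lemma P_D_nonzero: "P_poly \<noteq> 0" "D_poly \<noteq> 0"
  by (simp_all add: P_poly_def D_poly_def)

lemma plants_in_RH_inf: "Fract P_poly D_poly \<in> RH_inf" "Fract D_poly P_poly \<in> RH_inf"
  by (rule Fract_in_RH_inf[OF P_D_nonzero(2) _ D_roots] Fract_in_RH_inf[OF P_D_nonzero(1) _ P_roots];
      simp add: P_poly_def D_poly_def)+

lemma circle_P_D:
  fixes z :: complex
  assumes z: "norm z = 1"
  shows "poly (map_poly of_real P_poly) z \<noteq> 0" "poly (map_poly of_real D_poly) z \<noteq> 0"
    and "Re (1 + of_real (4/5) / z\<^sup>2) > 0"
proof -
  show "poly (map_poly of_real P_poly) z \<noteq> 0" "poly (map_poly of_real D_poly) z \<noteq> 0"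
    using P_roots[of z] D_roots[of z] z by auto
  \<comment> \<open>The second summand has modulus 4/5 on the circle.\<close>
  show "Re (1 + of_real (4/5) / z\<^sup>2) > 0"
    using z by (intro Re_one_plus_pos) (simp add: norm_divide norm_mult norm_power)
qed

lemma first_plant_suitable: "\<exists>M\<in>ZF. suitable M (Fract P_poly D_poly)"
proof -
  obtain M where M: "M \<in> ZF" "\<And>z. norm z = 1 \<Longrightarrow> M z = 1 - of_real (4/5) * z powi (- 1)"
    using monomial_multiplier[of 1 "4/5"] by auto
  \<comment> \<open>The inequality is proved on the whole circle, which contains the arc that
    \<open>suitable\<close> tests.\<close>
  have "Re (M z * rat_eval (Fract P_poly D_poly) z) > 0" if z: "norm z = 1" for z
  proof -
    have z0: "z \<noteq> 0" using z by auto
    have D: "z\<^sup>2 - of_real (4/5) * z \<noteq> 0"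
      using circle_P_D(2)[OF z] unfolding poly_D .
    have "M z = (z\<^sup>2 - of_real (4/5) * z) / z\<^sup>2"
      unfolding M(2)[OF z] using z0
      by (simp add: power_int_minus field_simps power2_eq_square)
    moreover have "rat_eval (Fract P_poly D_poly) z
        = (z\<^sup>2 + of_real (4/5)) / (z\<^sup>2 - of_real (4/5) * z)"
      using rat_eval_Fract[OF circle_P_D(2)[OF z], of P_poly] by (simp only: poly_P poly_D)
    ultimately have "M z * rat_eval (Fract P_poly D_poly) z = (z\<^sup>2 + of_real (4/5)) / z\<^sup>2"
      using D by (simp del: of_real_divide)
    also have "\<dots> = 1 + of_real (4/5) / z\<^sup>2"
      using z0 by (simp add: add_divide_distrib)
    finally show ?thesis using circle_P_D(3)[OF z] by simp
  qed
  with M(1) show ?thesis unfolding suitable_def by (metis norm_cis)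
qed

lemma second_plant_suitable: "\<exists>M\<in>ZF. suitable M (Fract D_poly P_poly)"
proof -
  obtain M where M: "M \<in> ZF" "\<And>z. norm z = 1 \<Longrightarrow> M z = 1 - of_real (4/5) * z powi (- (- 1))"
    using monomial_multiplier[of "-1" "4/5"] by auto
  have "Re (M z * rat_eval (Fract D_poly P_poly) z) > 0" if z: "norm z = 1" for z
  proof -
    have z0: "z \<noteq> 0" using z by auto
    \<comment> \<open>\<open>w\<close> is the value of D at \<open>z\<close>; the factor z^2 is then
      common to numerator and denominator of the plant and cancels.\<close>
    define w where "w = 1 - of_real (4/5) / z"
    have w: "z\<^sup>2 - of_real (4/5) * z = z\<^sup>2 * w"
      using z0 by (simp add: w_def field_simps power2_eq_square)
    have w0: "w \<noteq> 0"
      using circle_P_D(2)[OF z] unfolding poly_D w by auto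
    have P: "z\<^sup>2 + of_real (4/5) = z\<^sup>2 * (1 + of_real (4/5) / z\<^sup>2)"
      using z0 by (simp add: distrib_left)
    \<comment> \<open>On the circle conjugation is inversion, which turns the anticausal multiplier
      into the conjugate of \<open>w\<close>, so that the product has numerator |w|^2.\<close>
    have "cnj z = 1 / z"
      using z z0 complex_norm_square[of z] by (simp add: eq_divide_eq mult.commute)
    then have "cnj w = 1 - of_real (4/5) * z"
      using z0 by (simp add: w_def)
    then have "M z = cnj w"
      using M(2)[OF z] by simp
    moreover have "rat_eval (Fract D_poly P_poly) z = w / (1 + of_real (4/5) / z\<^sup>2)"
      using rat_eval_Fract[OF circle_P_D(1)[OF z], of D_poly] z0
      unfolding poly_P poly_D w P by simp
    ultimately have "M z * rat_eval (Fract D_poly P_poly) z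
        = of_real ((norm w)\<^sup>2) / (1 + of_real (4/5) / z\<^sup>2)"
      unfolding complex_norm_square by (simp add: mult.commute)
    then show ?thesis
      using Re_of_real_divide_pos[OF _ circle_P_D(3)[OF z], of "(norm w)\<^sup>2"] w0 by simp
  qed
  with M(1) show ?thesis unfolding suitable_def by (metis norm_cis)
qed

lemma rat_eval_mean:
  "rat_eval ((1/2) *\<^sub>R Fract P_poly D_poly + (1/2) *\<^sub>R Fract D_poly P_poly) (cis (pi/3))
    = of_real (-1/7)"
proof -
  define z where "z = cis (pi/3)"
  have z: "norm z = 1" by (simp add: z_def)
  let ?e = "\<lambda>p. poly (map_poly of_real p) z"
  have zc: "z = Complex (1/2) (sqrt 3 / 2)"
    by (simp add: z_def complex_eq_iff cos_60 sin_60)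
  \<comment> \<open>\<open>z\<close> is a primitive sixth root of unity, hence a root of x^2 - x +
    1; this makes both polynomials linear in \<open>z\<close>.\<close>
  have z2: "z\<^sup>2 = z - 1"
    by (simp add: zc complex_eq_iff power2_eq_square)
  have P: "?e P_poly = z - of_real (1/5)" and D: "?e D_poly = z / 5 - 1"
    unfolding poly_P poly_D z2 by (simp_all add: complex_eq_iff)
  have "(1/2) *\<^sub>R Fract P_poly D_poly + (1/2) *\<^sub>R Fract D_poly P_poly
      = Fract (smult (1/2) (P_poly * P_poly + D_poly * D_poly)) (D_poly * P_poly)"
    using P_D_nonzero by (simp add: scaleR_Fract smult_add_right)
  \<comment> \<open>With this, \<open>rat_eval_Fract\<close> evaluates the mean at \<open>z\<close>
    from the fraction over the common denominator.\<close>
  moreover have "?e (D_poly * P_poly) \<noteq> 0"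
    using circle_P_D(1,2)[OF z] by (simp add: map_poly_of_real_mult)
  moreover have "?e (smult (1/2) (P_poly * P_poly + D_poly * D_poly))
      = ((?e P_poly)\<^sup>2 + (?e D_poly)\<^sup>2) / 2"
  proof -
    have "map_poly of_real (smult (1/2) (P_poly * P_poly + D_poly * D_poly))
      = smult (1/2 :: complex) (map_poly of_real P_poly * map_poly of_real P_poly
          + map_poly of_real D_poly * map_poly of_real D_poly)"
      unfolding map_poly_of_real_mult[symmetric]
      by (rule poly_eqI) (simp add: coeff_map_poly)
    then show ?thesis by (simp add: power2_eq_square)
  qed
  \<comment> \<open>Reducing by z^2 = z - 1, the left side is 3z/25 and the product on the right is
    -21z/25, whence the ratio -1/7.\<close>
  moreover have "((?e P_poly)\<^sup>2 + (?e D_poly)\<^sup>2) / 2 = of_real (-1/7) * ?e (D_poly * P_poly)"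
    unfolding map_poly_of_real_mult poly_mult P D
    by (simp add: zc complex_eq_iff power2_eq_square)
  ultimately show ?thesis
    using rat_eval_Fract unfolding z_def by simp
qed

text \<open>The two plants have multipliers already in the smaller class \<open>ZF\<close>, while
  their mean has none even in the larger class \<open>ZF_odd\<close>; both claims of the theorem are
  thus instances.\<close>

lemma not_convex_plants:
  assumes "ZF \<subseteq> \<M>" "\<M> \<subseteq> ZF_odd"
  shows "\<not> convex {G \<in> RH_inf. \<exists>M\<in>\<M>. suitable M G}"
proof
  let ?S = "{G \<in> RH_inf. \<exists>M\<in>\<M>. suitable M G}"
  assume "convex ?S"
  moreover have "Fract P_poly D_poly \<in> ?S" "Fract D_poly P_poly \<in> ?S"
    using plants_in_RH_inf first_plant_suitable second_plant_suitable assms(1) by auto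
  ultimately have "(1/2) *\<^sub>R Fract P_poly D_poly + (1/2) *\<^sub>R Fract D_poly P_poly \<in> ?S"
    by (rule convexD) auto
  then obtain M where "M \<in> ZF_odd"
    "suitable M ((1/2) *\<^sub>R Fract P_poly D_poly + (1/2) *\<^sub>R Fract D_poly P_poly)"
    using assms(2) by auto
  then show False
    using not_suitable_negative_real[OF _ _ rat_eval_mean] by simp
qed

theorem theorem8:
  shows "\<not> convex {G \<in> RH_inf. \<exists>M\<in>ZF. suitable M G}
       \<and> \<not> convex {G \<in> RH_inf. \<exists>M\<in>ZF_odd. suitable M G}"
  using not_convex_plants ZF_subset_ZF_odd by simp

end
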